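(* For all integers $k,\ell\geq 1$, $\alpha(k,\ell)=(k-1)(\ell-1)+2$.
   Context: A cyclic permutation of a finite set of distinct integers is an arrangement of its elements in a circle, written $(j_1,j_2,\ldots,j_n)$, where two such expressions denote the same cyclic permutation if one is a cyclic rotation of the other; its length is $n$. A cyclic sub-permutation of a cyclic permutation $\sigma$ is obtained by deleting some elements from $\sigma$ and keeping the remaining ones in their cyclic order. A cyclic permutation is increasing if it can be written as $(j_1,\ldots,j_n)$ with $j_1<j_2<\cdots<j_n$, and decreasing if it can be written as $(j_1,\ldots,j_n)$ with $j_1>j_2>\cdots>j_n$. For positive integers $k,\ell$, $\alpha(k,\ell)$ denotes the smallest positive integer $n$ such that every cyclic permutation of $\{1,\ldots,n\}$ has an increasing cyclic sub-permutation of length $k+1$ or a decreasing cyclic sub-permutation of length $\ell+1$. *)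

theory Defs
  imports Main "HOL-Library.Sublist"
begin

definition rotation :: "'a list \<Rightarrow> 'a list \<Rightarrow> bool" where
  "rotation xs ys \<longleftrightarrow> (\<exists>i. ys = rotate i xs)"

lemma equivp_rotation: "equivp (rotation :: 'a list \<Rightarrow> 'a list \<Rightarrow> bool)"
proof (rule equivpI)
  show "reflp (rotation :: 'a list \<Rightarrow> 'a list \<Rightarrow> bool)"
    unfolding reflp_def rotation_def by (metis rotate0 id_apply)
  show "symp (rotation :: 'a list \<Rightarrow> 'a list \<Rightarrow> bool)"
  proof (rule sympI)
    fix xs ys :: "'a list"
    assume "rotation xs ys"
    then obtain i where i: "ys = rotate i xs"
      unfolding rotation_def by blast
    have "rotate (length xs - i mod length xs) ys
        = rotate (length xs - i mod length xs) (rotate (i mod length xs) xs)"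
      using i rotate_conv_mod by metis
    also have "\<dots> = rotate ((length xs - i mod length xs) + i mod length xs) xs"
      by (rule rotate_rotate)
    also have "\<dots> = xs"
      by (cases "xs = []") (simp_all add: less_imp_le)
    finally show "rotation ys xs"
      unfolding rotation_def by metis
  qed
  show "transp (rotation :: 'a list \<Rightarrow> 'a list \<Rightarrow> bool)"
    unfolding transp_def rotation_def by (metis rotate_rotate)
qed

text \<open>Circular arrangements: lists up to cyclic rotation. Repeated entries are not excluded
  by the type; a cyclic permutation is a circular arrangement with distinct entries.\<close>

quotient_type 'a cyc = "'a list" / rotation
  by (rule equivp_rotation)

lift_definition cyc_of :: "'a list \<Rightarrow> 'a cyc" is "\<lambda>xs. xs" .

lift_definition cyc_set :: "'a cyc \<Rightarrow> 'a set" is set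
  by (auto simp: rotation_def)

lift_definition cyc_length :: "'a cyc \<Rightarrow> nat" is length
  by (auto simp: rotation_def)

lift_definition cyc_distinct :: "'a cyc \<Rightarrow> bool" is distinct
  by (auto simp: rotation_def)

definition cyclic_permutation_of :: "'a set \<Rightarrow> 'a cyc \<Rightarrow> bool" where
  "cyclic_permutation_of A \<sigma> \<longleftrightarrow> cyc_distinct \<sigma> \<and> cyc_set \<sigma> = A"

definition cyclic_subpermutation :: "'a cyc \<Rightarrow> 'a cyc \<Rightarrow> bool" where
  "cyclic_subpermutation \<tau> \<sigma> \<longleftrightarrow>
     (\<exists>xs ys. \<sigma> = cyc_of xs \<and> \<tau> = cyc_of ys \<and> subseq ys xs)"

definition cyc_increasing :: "'a::linorder cyc \<Rightarrow> bool" where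
  "cyc_increasing \<sigma> \<longleftrightarrow> (\<exists>xs. \<sigma> = cyc_of xs \<and> sorted_wrt (<) xs)"

definition cyc_decreasing :: "'a::linorder cyc \<Rightarrow> bool" where
  "cyc_decreasing \<sigma> \<longleftrightarrow> (\<exists>xs. \<sigma> = cyc_of xs \<and> sorted_wrt (>) xs)"

definition alpha :: "nat \<Rightarrow> nat \<Rightarrow> nat" where
  "alpha k l = (LEAST n. n > 0 \<and>
     (\<forall>\<sigma>. cyclic_permutation_of {1..int n} \<sigma> \<longrightarrow>
        (\<exists>\<tau>. cyclic_subpermutation \<tau> \<sigma> \<and> cyc_increasing \<tau> \<and> cyc_length \<tau> = k + 1) \<or>
        (\<exists>\<tau>. cyclic_subpermutation \<tau> \<sigma> \<and> cyc_decreasing \<tau> \<and> cyc_length \<tau> = l + 1)))"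

end

theory Submission
  imports Defs
begin

text \<open>Upper bound: cut the circle at its minimum and apply the Erdos--Szekeres theorem to
  the remaining \<open>(k - 1) * (l - 1) + 1\<close> entries. The minimum extends an increasing sequence at its
  front and, after a rotation, a decreasing one at its end.

  Lower bound: put \<open>K = k - 1\<close>, \<open>L = l - 1\<close>, \<open>N = K * L + 1\<close> and place the value \<open>v x = L * x mod N\<close> at
  position \<open>x\<close>, viewed as an \<open>N\<close>-periodic function. The points \<open>(x, v x)\<close> lie in the lattice
  generated by \<open>(1, L)\<close> and \<open>(K, -1)\<close>, in which they have the integer coordinates
  \<open>(x + K * v x) / N\<close> and \<open>(L * x - v x) / N\<close>. Along a cyclically increasing sequence the first
  coordinate strictly increases, but by less than \<open>K + 1\<close> overall; along a cyclically decreasing one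
  the second strictly increases, but by less than \<open>L + 1\<close>. For fewer than \<open>N\<close> entries, delete the
  largest ones.\<close>

section \<open>Cyclic arrangements as lists\<close>

text \<open>Cutting a list in two and swapping the pieces replaces arithmetic on rotation amounts,
  so that the lemmas on subsequences of appended lists apply.\<close>

lemma rotation_iff_append: "rotation xs ys \<longleftrightarrow> (\<exists>us vs. xs = us @ vs \<and> ys = vs @ us)"
proof
  assume "rotation xs ys"
  then obtain i where "ys = rotate i xs"
    by (auto simp: rotation_def)
  then have "ys = drop (i mod length xs) xs @ take (i mod length xs) xs"
    by (simp add: rotate_drop_take)
  then show "\<exists>us vs. xs = us @ vs \<and> ys = vs @ us"
    by (metis append_take_drop_id)
next
  assume "\<exists>us vs. xs = us @ vs \<and> ys = vs @ us"
  then show "rotation xs ys"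
    unfolding rotation_def by (metis rotate_append)
qed

lemma rotation_sym: "rotation xs ys \<Longrightarrow> rotation ys xs"
  by (rule equivp_symp[OF equivp_rotation])

lemma rotation_trans: "rotation xs ys \<Longrightarrow> rotation ys zs \<Longrightarrow> rotation xs zs"
  by (rule equivp_transp[OF equivp_rotation])

lemma cyc_of_eq_iff: "cyc_of xs = cyc_of ys \<longleftrightarrow> rotation xs ys"
  by transfer simp

lemma cyc_of_cases: obtains xs where "\<sigma> = cyc_of xs"
proof -
  have "\<exists>xs. \<sigma> = cyc_of xs"
    by transfer (use equivp_reflp[OF equivp_rotation] in blast)
  then show thesis
    using that by blast
qed

text \<open>The cut of \<open>xs\<close> induces a cut of \<open>ys\<close>; swapping the pieces of
  both keeps the embedding.\<close>

lemma subseq_rotation: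
  assumes "subseq ys xs" "rotation xs ws"
  obtains zs where "rotation ys zs" "subseq zs ws"
proof -
  obtain us vs where "xs = us @ vs" "ws = vs @ us"
    using assms(2) by (auto simp: rotation_iff_append)
  moreover from this obtain ys1 ys2 where "ys = ys1 @ ys2" "subseq ys1 us" "subseq ys2 vs"
    using assms(1) by (auto elim: subseq_appendE)
  ultimately show thesis
    using that[of "ys2 @ ys1"] by (auto simp: rotation_iff_append list_emb_append_mono)
qed

text \<open>Fixes both representatives at once: \<open>zs\<close> can be the monotone listing and
  \<open>ws\<close> the chosen word. The price is that \<open>zs\<close> may run past the end of
  \<open>ws\<close> and continue at its start, once.\<close>

lemma cyclic_subpermutation_cyc_ofE:
  assumes "cyclic_subpermutation (cyc_of zs) (cyc_of ws)"
  obtains as bs where "zs = bs @ as" "subseq (as @ bs) ws"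
proof -
  obtain xs ys where "rotation ws xs" "rotation zs ys" "subseq ys xs"
    using assms by (auto simp: cyclic_subpermutation_def cyc_of_eq_iff)
  then obtain zs' where "rotation ys zs'" "subseq zs' ws"
    using subseq_rotation rotation_sym by metis
  moreover from this have "rotation zs zs'"
    using \<open>rotation zs ys\<close> rotation_trans by blast
  ultimately show thesis
    using that by (auto simp: rotation_iff_append)
qed

section \<open>The Erdos--Szekeres theorem\<close>

text \<open>Induction step of the labelling, for any transitive \<open>R\<close> so that it serves
  both orders. The label \<open>m\<close> of the new head \<open>x\<close> is one more than the
  largest label of an entry \<open>y\<close> with \<open>R x y\<close>, or 1 if there is
  none.\<close>

lemma sorted_subseq_lengths:
  fixes R :: "'a \<Rightarrow> 'a \<Rightarrow> bool"
  assumes "transp R"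
    and f: "\<And>y. y \<in> set xs \<Longrightarrow>
      \<exists>ys. subseq (y # ys) xs \<and> sorted_wrt R (y # ys) \<and> length (y # ys) = f y"
  obtains m where "\<exists>ys. subseq (x # ys) (x # xs) \<and> sorted_wrt R (x # ys) \<and> length (x # ys) = m"
    and "\<And>y. y \<in> set xs \<Longrightarrow> R x y \<Longrightarrow> f y < m"
proof (cases "{y \<in> set xs. R x y} = {}")
  case True
  show thesis
    by (rule that[of 1]) (use True in \<open>auto intro: exI[of _ "[]"]\<close>)
next
  case False
  define M where "M = Max (f ` {y \<in> set xs. R x y})"
  have "M \<in> f ` {y \<in> set xs. R x y}"
    unfolding M_def using False by (intro Max_in) auto
  then obtain y where y: "y \<in> set xs" "R x y" "M = f y"
    by auto
  obtain ys where ys: "subseq (y # ys) xs" "sorted_wrt R (y # ys)" "length (y # ys) = f y"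
    using f[OF y(1)] by blast
  show thesis
  proof (rule that[of "Suc M"])
    have "sorted_wrt R (x # y # ys)"
      using ys(2) y(2) transpD[OF assms(1)] by auto
    then show "\<exists>ys. subseq (x # ys) (x # xs) \<and> sorted_wrt R (x # ys) \<and> length (x # ys) = Suc M"
      using ys y(3) by (intro exI[of _ "y # ys"]) auto
    show "f z < Suc M" if "z \<in> set xs" "R x z" for z
      unfolding M_def using that by (simp add: less_Suc_eq_le)
  qed
qed

text \<open>Of two distinct entries, the earlier one gets the larger \<open>f\<close> if it is the
  smaller one, and the larger \<open>g\<close> otherwise, so the pair of labels tells them
  apart.\<close>

lemma sorted_subseq_labelling:
  fixes xs :: "'a::linorder list"
  assumes "distinct xs"
  shows "\<exists>f g. inj_on (\<lambda>x. (f x, g x)) (set xs) \<and>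
    (\<forall>x\<in>set xs. (\<exists>ys. subseq (x # ys) xs \<and> sorted_wrt (<) (x # ys) \<and> length (x # ys) = f x) \<and>
                (\<exists>ys. subseq (x # ys) xs \<and> sorted_wrt (>) (x # ys) \<and> length (x # ys) = g x))"
  using assms
proof (induction xs)
  case Nil
  then show ?case by simp
next
  case (Cons x xs)
  then obtain f g where inj: "inj_on (\<lambda>x. (f x, g x)) (set xs)"
    and f: "\<And>y. y \<in> set xs \<Longrightarrow>
      \<exists>ys. subseq (y # ys) xs \<and> sorted_wrt (<) (y # ys) \<and> length (y # ys) = f y"
    and g: "\<And>y. y \<in> set xs \<Longrightarrow>
      \<exists>ys. subseq (y # ys) xs \<and> sorted_wrt (>) (y # ys) \<and> length (y # ys) = g y"
    by auto
  have x: "x \<notin> set xs"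
    using Cons.prems by simp
  obtain m where m: "\<exists>ys. subseq (x # ys) (x # xs) \<and> sorted_wrt (<) (x # ys) \<and> length (x # ys) = m"
    "\<And>y. y \<in> set xs \<Longrightarrow> x < y \<Longrightarrow> f y < m"
    using sorted_subseq_lengths[where x = x, OF _ f] by auto
  obtain n where n: "\<exists>ys. subseq (x # ys) (x # xs) \<and> sorted_wrt (>) (x # ys) \<and> length (x # ys) = n"
    "\<And>y. y \<in> set xs \<Longrightarrow> x > y \<Longrightarrow> g y < n"
    using sorted_subseq_lengths[where x = x, OF _ g] by auto
  have weaken: "\<exists>ys. subseq (y # ys) (x # xs) \<and> P ys" if "\<exists>ys. subseq (y # ys) xs \<and> P ys" for y P
    using that list_emb_Cons by metis
  have "(f y, g y) \<noteq> (m, n)" if "y \<in> set xs" for y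
    using m(2)[OF that] n(2)[OF that] x that by (cases x y rule: linorder_cases) auto
  then have "inj_on (\<lambda>y. ((f(x := m)) y, (g(x := n)) y)) (set (x # xs))"
    using inj x by (auto simp: inj_on_def)
  moreover have "\<exists>ys. subseq (y # ys) (x # xs) \<and> sorted_wrt (<) (y # ys) \<and>
      length (y # ys) = (f(x := m)) y" if "y \<in> set (x # xs)" for y
    using m(1) weaken[OF f, of y] that by (cases "y = x") (simp_all del: subseq_Cons2_iff)
  moreover have "\<exists>ys. subseq (y # ys) (x # xs) \<and> sorted_wrt (>) (y # ys) \<and>
      length (y # ys) = (g(x := n)) y" if "y \<in> set (x # xs)" for y
    using n(1) weaken[OF g, of y] that by (cases "y = x") (simp_all del: subseq_Cons2_iff)
  ultimately show ?case
    by blast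
qed

lemma subseq_take: "subseq (take n xs) xs"
  by (metis append_take_drop_id list_emb_append2 subseq_order.refl subseq_rev_drop_many)

text \<open>Pigeonhole: without such subsequences the label pairs lie in a \<open>K\<close> by
  \<open>L\<close> box, too small for more than \<open>K * L\<close> entries.\<close>

theorem Erdos_Szekeres:
  fixes xs :: "'a::linorder list"
  assumes "distinct xs" "length xs > K * L"
  shows "(\<exists>ys. subseq ys xs \<and> sorted_wrt (<) ys \<and> length ys = K + 1) \<or>
         (\<exists>ys. subseq ys xs \<and> sorted_wrt (>) ys \<and> length ys = L + 1)"
proof (rule ccontr)
  assume neg: "\<not> ?thesis"
  obtain f g where inj: "inj_on (\<lambda>x. (f x, g x)) (set xs)"
    and f: "\<And>y. y \<in> set xs \<Longrightarrow>
      \<exists>ys. subseq (y # ys) xs \<and> sorted_wrt (<) (y # ys) \<and> length (y # ys) = f y"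
    and g: "\<And>y. y \<in> set xs \<Longrightarrow>
      \<exists>ys. subseq (y # ys) xs \<and> sorted_wrt (>) (y # ys) \<and> length (y # ys) = g y"
    using sorted_subseq_labelling[OF assms(1)] by blast
  \<comment> \<open>The negated goal excludes only the exact length \<open>n + 1\<close>; truncation
    excludes all greater lengths as well.\<close>
  have short: "length ys \<le> n"
    if "\<not> (\<exists>ys. subseq ys xs \<and> sorted_wrt R ys \<and> length ys = n + 1)" "subseq ys xs" "sorted_wrt R ys"
    for R :: "'a \<Rightarrow> 'a \<Rightarrow> bool" and ys n
  proof (rule ccontr)
    assume "\<not> length ys \<le> n"
    then have "subseq (take (n + 1) ys) xs" "sorted_wrt R (take (n + 1) ys)"
      "length (take (n + 1) ys) = n + 1"
      using that subseq_order.trans[OF subseq_take] by (auto simp: sorted_wrt_take)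
    then show False
      using that(1) by blast
  qed
  have "(\<lambda>x. (f x, g x)) ` set xs \<subseteq> {1..K} \<times> {1..L}"
  proof (rule image_subsetI)
    fix x assume x: "x \<in> set xs"
    have "f x \<le> K" "1 \<le> f x"
      using f[OF x] neg short[of "(<)" K] by force+
    moreover have "g x \<le> L" "1 \<le> g x"
      using g[OF x] neg short[of "(>)" L] by force+
    ultimately show "(f x, g x) \<in> {1..K} \<times> {1..L}"
      by simp
  qed
  then have "card (set xs) \<le> card ({1..K} \<times> {1..L})"
    using card_inj_on_le[OF inj] by blast
  then show False
    using assms by (simp add: distinct_card)
qed

section \<open>The upper bound for cyclic arrangements\<close>

lemma cyclic_Erdos_Szekeres:
  fixes \<sigma> :: "'a::linorder cyc"
  assumes "cyc_distinct \<sigma>" "cyc_length \<sigma> \<ge> K * L + 2"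
  shows "(\<exists>\<tau>. cyclic_subpermutation \<tau> \<sigma> \<and> cyc_increasing \<tau> \<and> cyc_length \<tau> = K + 2) \<or>
         (\<exists>\<tau>. cyclic_subpermutation \<tau> \<sigma> \<and> cyc_decreasing \<tau> \<and> cyc_length \<tau> = L + 2)"
proof -
  obtain ws where ws: "\<sigma> = cyc_of ws"
    by (rule cyc_of_cases)
  have len: "distinct ws" "length ws \<ge> K * L + 2"
    using assms by (simp_all add: ws cyc_distinct.abs_eq cyc_length.abs_eq cyc_of.abs_eq)
  define a where "a = Min (set ws)"
  have "a \<in> set ws"
    unfolding a_def using len(2) by (intro Min_in) auto
  then obtain us vs where uv: "ws = us @ a # vs"
    by (meson split_list)
  define xs where "xs = vs @ us"
  have "rotation ws (a # xs)"
    unfolding rotation_iff_append by (intro exI[of _ us] exI[of _ "a # vs"]) (simp add: uv xs_def)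
  then have \<sigma>: "\<sigma> = cyc_of (a # xs)"
    by (simp add: ws cyc_of_eq_iff)
  have less: "a < x" if "x \<in> set xs" for x
  proof -
    have "a \<le> x"
      unfolding a_def using that by (auto simp: uv xs_def)
    then show ?thesis
      using that len(1) by (auto simp: uv xs_def order.order_iff_strict)
  qed
  have "distinct xs" "length xs > K * L"
    using len by (auto simp: uv xs_def)
  then consider ys where "subseq ys xs" "sorted_wrt (<) ys" "length ys = K + 1"
    | ys where "subseq ys xs" "sorted_wrt (>) ys" "length ys = L + 1"
    using Erdos_Szekeres[of xs K L] by blast
  then show ?thesis
  proof cases
    case 1
    then have "sorted_wrt (<) (a # ys)"
      using less by (auto dest: list_emb_set)
    moreover have "cyclic_subpermutation (cyc_of (a # ys)) \<sigma>"
      using 1 by (auto simp: cyclic_subpermutation_def \<sigma> intro!: exI)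
    moreover have "cyc_length (cyc_of (a # ys)) = K + 2"
      using 1 by (simp add: cyc_length.abs_eq cyc_of.abs_eq)
    ultimately show ?thesis
      unfolding cyc_increasing_def by blast
  next
    case 2
    then have "sorted_wrt (>) (ys @ [a])"
      using less by (auto simp: sorted_wrt_append dest: list_emb_set)
    \<comment> \<open>\<open>a # ys\<close> embeds in \<open>a # xs\<close>, while
      \<open>ys @ [a]\<close> is the decreasing listing; both describe the same circle.\<close>
    moreover have "cyc_of (a # ys) = cyc_of (ys @ [a])"
      unfolding cyc_of_eq_iff rotation_iff_append by (intro exI[of _ "[a]"] exI[of _ ys]) simp
    moreover have "cyclic_subpermutation (cyc_of (a # ys)) \<sigma>"
      using 2 by (auto simp: cyclic_subpermutation_def \<sigma> intro!: exI)
    moreover have "cyc_length (cyc_of (a # ys)) = L + 2"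
      using 2 by (simp add: cyc_length.abs_eq cyc_of.abs_eq)
    ultimately show ?thesis
      unfolding cyc_decreasing_def by blast
  qed
qed

section \<open>The extremal arrangement\<close>

text \<open>The values of \<open>g\<close> are distinct integers in an interval of
  \<open>n + 1\<close> integers that starts at the value of the first entry.\<close>

lemma sorted_wrt_less_length_le:
  fixes g :: "'a \<Rightarrow> int"
  assumes "sorted_wrt (\<lambda>p q. g p < g q) qs"
    and "\<And>p q. p \<in> set qs \<Longrightarrow> q \<in> set qs \<Longrightarrow> g q - g p \<le> int n"
  shows "length qs \<le> n + 1"
proof (cases qs)
  case (Cons p ps)
  have "distinct (map g qs)"
    using assms(1) strict_sorted_iff[of "map g qs"] by (simp add: sorted_wrt_map)
  then have "length qs = card (g ` set qs)"
    by (metis distinct_card length_map list.set_map)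
  also have "g ` set qs \<subseteq> {g p..g p + int n}"
    using assms Cons by force
  then have "card (g ` set qs) \<le> card {g p..g p + int n}"
    by (intro card_mono) auto
  finally show ?thesis
    by simp
qed simp

locale extremal_arrangement =
  fixes K L :: nat
begin

text \<open>Up to sign the determinant of the lattice basis, and one below the claimed value of
  \<alpha>. Modulo \<open>N\<close>, \<open>K * L\<close> is -1, so multiplication by
  \<open>L\<close> permutes the residues.\<close>

definition N :: int where "N = int K * int L + 1"

definition v :: "int \<Rightarrow> int" where "v x = int L * x mod N"

definition word :: "int list" where "word = map (\<lambda>x. v x + 1) [0..N - 1]"

lemma N_pos: "N > 0"
  by (simp add: N_def add_nonneg_pos)

lemma v_bounds: "0 \<le> v x" "v x < N"
  using N_pos by (simp_all add: v_def)

lemma v_add_N: "v (x + N) = v x"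
  by (simp add: v_def distrib_left)

definition inc_coord :: "int \<Rightarrow> int" where "inc_coord x = (x + int K * v x) div N"

definition dec_coord :: "int \<Rightarrow> int" where "dec_coord x = (int L * x - v x) div N"

text \<open>\<open>v x\<close> is the remainder of \<open>L * x\<close> modulo \<open>N\<close>, so
  the division is exact and the coordinate is the quotient belonging to that remainder.\<close>

lemma N_times_dec_coord: "N * dec_coord x = int L * x - v x"
  by (simp add: dec_coord_def v_def minus_mod_eq_mult_div)

text \<open>Replacing \<open>v x\<close> by \<open>L * x - N * dec_coord x\<close> turns the factor
  of \<open>x\<close> into \<open>1 + K * L = N\<close>, so this division is exact too.\<close>

lemma N_times_inc_coord: "N * inc_coord x = x + int K * v x"
proof -
  have "x + int K * v x = x + int K * (int L * x - N * dec_coord x)"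
    by (simp add: N_times_dec_coord)
  also have "\<dots> = N * (x - int K * dec_coord x)"
    by (simp add: N_def algebra_simps)
  finally show ?thesis
    unfolding inc_coord_def by simp
qed

text \<open>Equal values leave \<open>x - y\<close> as a multiple of \<open>N\<close>, and two
  positions in one period differ by less.\<close>

lemma inj_on_v: "inj_on v {0..N - 1}"
proof (rule inj_onI)
  fix x y assume xy: "x \<in> {0..N - 1}" "y \<in> {0..N - 1}" "v x = v y"
  have "x - y = N * (inc_coord x - inc_coord y)"
    using N_times_inc_coord[of x] N_times_inc_coord[of y] xy(3) by (simp add: algebra_simps)
  then have "N dvd x - y"
    by simp
  then show "x = y"
    using xy(1,2) zdvd_imp_le[of N "x - y"] zdvd_imp_le[of N "y - x"]
    by (cases x y rule: linorder_cases) (auto simp: dvd_diff_commute)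
qed

lemma distinct_word: "distinct word"
  using inj_on_v by (auto simp: word_def distinct_map inj_on_def)

lemma set_word: "set word = {1..N}"
proof (rule card_subset_eq)
  show "set word \<subseteq> {1..N}"
    using v_bounds by (auto simp: word_def add_increasing zless_imp_add1_zle)
  have "card (set word) = length word"
    by (rule distinct_card[OF distinct_word])
  then show "card (set word) = card {1..N}"
    by (simp add: word_def)
qed simp

text \<open>\<open>bs\<close> sits at the end of one period and \<open>as\<close> at the start of
  the next. Shifting the positions of \<open>as\<close> by \<open>N\<close> leaves the values of
  \<open>v\<close> unchanged and turns the wrapped sequence into an increasing list of positions
  within a window of length \<open>N\<close>.\<close>

lemma unrolled_positions:
  assumes "subseq (as @ bs) word" "sorted_wrt R (bs @ as)"
  obtains qs where "length qs = length (bs @ as)" "sorted_wrt (<) qs"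
    "sorted_wrt (\<lambda>p q. R (v p + 1) (v q + 1)) qs"
    "\<And>p q. p \<in> set qs \<Longrightarrow> q \<in> set qs \<Longrightarrow> q - p < N"
proof -
  obtain I where "as @ bs = map (\<lambda>x. v x + 1) (nths [0..N - 1] I)"
    using assms(1) by (auto simp: word_def subseq_conv_nths nths_map)
  then obtain pas pbs where ps: "nths [0..N - 1] I = pas @ pbs"
    and as: "as = map (\<lambda>x. v x + 1) pas" and bs: "bs = map (\<lambda>x. v x + 1) pbs"
    unfolding append_eq_map_conv by blast
  have sorted: "sorted_wrt (<) (pas @ pbs)"
    unfolding ps[symmetric] by (simp add: strict_sorted_iff sorted_nths)
  have range: "set (pas @ pbs) \<subseteq> {0..N - 1}"
    unfolding ps[symmetric] by (metis set_nths_subset set_upto)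
  define qs where "qs = pbs @ map (\<lambda>x. x + N) pas"
  show thesis
  proof (rule that[of qs])
    show "length qs = length (bs @ as)"
      by (simp add: qs_def as bs)
    show "sorted_wrt (<) qs"
      using sorted range by (fastforce simp: qs_def sorted_wrt_append sorted_wrt_map)
    show "sorted_wrt (\<lambda>p q. R (v p + 1) (v q + 1)) qs"
      using assms(2) by (simp add: qs_def as bs sorted_wrt_append sorted_wrt_map v_add_N)
    show "q - p < N" if "p \<in> set qs" "q \<in> set qs" for p q
    proof -
      have bounds: "0 \<le> x" "x < N" if "x \<in> set pas \<union> set pbs" for x
        using range that by auto
      \<comment> \<open>Decisive when \<open>q\<close> is shifted and \<open>p\<close> is not: then
        \<open>q - N\<close> precedes \<open>p\<close>.\<close>
      have less: "x < y" if "x \<in> set pas" "y \<in> set pbs" for x y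
        using sorted that by (simp add: sorted_wrt_append)
      have "p \<in> set pbs \<or> p - N \<in> set pas" "q \<in> set pbs \<or> q - N \<in> set pas"
        using that by (auto simp: qs_def)
      then show ?thesis
        using bounds[of p] bounds[of q] bounds[of "p - N"] bounds[of "q - N"] less[of "q - N" p]
        by auto
    qed
  qed
qed

lemma increasing_length_le:
  assumes "subseq (as @ bs) word" "sorted_wrt (<) (bs @ as)"
  shows "length (bs @ as) \<le> K + 1"
proof -
  obtain qs where qs: "length qs = length (bs @ as)" "sorted_wrt (<) qs"
    "sorted_wrt (\<lambda>p q. v p + 1 < v q + 1) qs"
    "\<And>p q. p \<in> set qs \<Longrightarrow> q \<in> set qs \<Longrightarrow> q - p < N"
    using unrolled_positions[OF assms] by blast
  \<comment> \<open>Position and value enter with nonnegative weights, so growth of both forces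
    growth of the coordinate.\<close>
  have diff: "N * (inc_coord q - inc_coord p) = (q - p) + int K * (v q - v p)" for p q
    by (simp add: right_diff_distrib N_times_inc_coord)
  have "inc_coord p < inc_coord q" if "p < q" "v p + 1 < v q + 1" for p q
  proof -
    have "N * (inc_coord q - inc_coord p) > 0"
      unfolding diff using that by (simp add: add_pos_nonneg)
    then show ?thesis
      using N_pos by (simp add: zero_less_mult_iff)
  qed
  then have "sorted_wrt (\<lambda>p q. inc_coord p < inc_coord q) qs"
    using qs(2,3) unfolding sorted_wrt_iff_nth_less by blast
  moreover have "inc_coord q - inc_coord p \<le> int K" if "p \<in> set qs" "q \<in> set qs" for p q
  proof -
    \<comment> \<open>\<open>K\<close> may be 0, so this bound is not strict; strictness below comes
      from \<open>q - p < N\<close>.\<close>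
    have "int K * (v q - v p) \<le> int K * N"
      using v_bounds[of p] v_bounds[of q] by (intro mult_left_mono) auto
    then have "N * (inc_coord q - inc_coord p) < N * (int K + 1)"
      unfolding diff using qs(4)[OF that] by (simp add: algebra_simps)
    then show ?thesis
      using N_pos by simp
  qed
  ultimately show ?thesis
    using sorted_wrt_less_length_le qs(1) by metis
qed

lemma decreasing_length_le:
  assumes "subseq (as @ bs) word" "sorted_wrt (>) (bs @ as)"
  shows "length (bs @ as) \<le> L + 1"
proof -
  obtain qs where qs: "length qs = length (bs @ as)" "sorted_wrt (<) qs"
    "sorted_wrt (\<lambda>p q. v p + 1 > v q + 1) qs"
    "\<And>p q. p \<in> set qs \<Longrightarrow> q \<in> set qs \<Longrightarrow> q - p < N"
    using unrolled_positions[OF assms] by blast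
  have diff: "N * (dec_coord q - dec_coord p) = int L * (q - p) + (v p - v q)" for p q
    by (simp add: right_diff_distrib N_times_dec_coord)
  have "dec_coord p < dec_coord q" if "p < q" "v p + 1 > v q + 1" for p q
  proof -
    have "N * (dec_coord q - dec_coord p) > 0"
      unfolding diff using that by (simp add: add_nonneg_pos)
    then show ?thesis
      using N_pos by (simp add: zero_less_mult_iff)
  qed
  then have "sorted_wrt (\<lambda>p q. dec_coord p < dec_coord q) qs"
    using qs(2,3) unfolding sorted_wrt_iff_nth_less by blast
  moreover have "dec_coord q - dec_coord p \<le> int L" if "p \<in> set qs" "q \<in> set qs" for p q
  proof -
    \<comment> \<open>The roles are exchanged: the position term has the weak bound, and strictness
      comes from \<open>v p - v q < N\<close>.\<close>
    have "int L * (q - p) \<le> int L * N"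
      using qs(4)[OF that] by (intro mult_left_mono) auto
    then have "N * (dec_coord q - dec_coord p) < N * (int L + 1)"
      unfolding diff using v_bounds[of p] v_bounds[of q] by (simp add: algebra_simps)
    then show ?thesis
      using N_pos by simp
  qed
  ultimately show ?thesis
    using sorted_wrt_less_length_le qs(1) by metis
qed

lemma cyclic_permutation_without_long_monotone:
  assumes "int m \<le> N"
  obtains \<sigma> where "cyclic_permutation_of {1..int m} \<sigma>"
    "\<And>\<tau>. cyclic_subpermutation \<tau> \<sigma> \<Longrightarrow> cyc_increasing \<tau> \<Longrightarrow> cyc_length \<tau> \<le> K + 1"
    "\<And>\<tau>. cyclic_subpermutation \<tau> \<sigma> \<Longrightarrow> cyc_decreasing \<tau> \<Longrightarrow> cyc_length \<tau> \<le> L + 1"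
proof -
  \<comment> \<open>Subsequences of the filtered word are subsequences of \<open>word\<close>, so
    its length bounds carry over.\<close>
  define ws where "ws = filter (\<lambda>x. x \<le> int m) word"
  have sub: "subseq (as @ bs) word" if "subseq (as @ bs) ws" for as bs
    using that subseq_filter_left subseq_order.trans unfolding ws_def by blast
  have len: "cyc_length (cyc_of zs) = length zs" for zs :: "int list"
    by (simp add: cyc_length.abs_eq cyc_of.abs_eq)
  have "cyclic_permutation_of {1..int m} (cyc_of ws)"
    using assms by (auto simp: cyclic_permutation_of_def cyc_distinct.abs_eq cyc_set.abs_eq
        cyc_of.abs_eq ws_def distinct_word set_word)
  moreover have "cyc_length \<tau> \<le> K + 1" if \<tau>: "cyclic_subpermutation \<tau> (cyc_of ws)" "cyc_increasing \<tau>" for \<tau>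
  proof -
    obtain zs where zs: "\<tau> = cyc_of zs" "sorted_wrt (<) zs"
      using \<tau>(2) by (auto simp: cyc_increasing_def)
    obtain as bs where "zs = bs @ as" "subseq (as @ bs) ws"
      using \<tau>(1) unfolding zs by (rule cyclic_subpermutation_cyc_ofE)
    then show ?thesis
      using zs increasing_length_le[OF sub] by (simp add: len)
  qed
  moreover have "cyc_length \<tau> \<le> L + 1" if \<tau>: "cyclic_subpermutation \<tau> (cyc_of ws)" "cyc_decreasing \<tau>" for \<tau>
  proof -
    obtain zs where zs: "\<tau> = cyc_of zs" "sorted_wrt (>) zs"
      using \<tau>(2) by (auto simp: cyc_decreasing_def)
    obtain as bs where "zs = bs @ as" "subseq (as @ bs) ws"
      using \<tau>(1) unfolding zs by (rule cyclic_subpermutation_cyc_ofE)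
    then show ?thesis
      using zs decreasing_length_le[OF sub] by (simp add: len)
  qed
  ultimately show thesis
    by (rule that)
qed

end

section \<open>The exact value of \<alpha>\<close>

lemma cyc_length_eq_card: "cyc_distinct \<sigma> \<Longrightarrow> cyc_length \<sigma> = card (cyc_set \<sigma>)"
  by transfer (simp add: distinct_card)

theorem theorem1:
  fixes k l :: nat
  assumes "k \<ge> 1" and "l \<ge> 1"
  shows "alpha k l = (k - 1) * (l - 1) + 2"
proof -
  \<comment> \<open>The offsets avoid truncated subtraction; the sought lengths \<open>k + 1\<close>
    and \<open>l + 1\<close> become \<open>K + 2\<close> and \<open>L + 2\<close>, one above the
    bounds for the extremal arrangement.\<close>
  define K L where "K = k - 1" and "L = l - 1"
  have kl: "k = K + 1" "l = L + 1"
    using assms by (simp_all add: K_def L_def)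
  have "alpha k l = K * L + 2"
    unfolding alpha_def
  proof (rule Least_equality, intro conjI allI impI)
    fix \<sigma> assume "cyclic_permutation_of {1..int (K * L + 2)} \<sigma>"
    then have "cyc_distinct \<sigma>" "cyc_length \<sigma> \<ge> K * L + 2"
      by (simp_all add: cyclic_permutation_of_def cyc_length_eq_card del: of_nat_add of_nat_mult)
    from cyclic_Erdos_Szekeres[OF this]
    show "(\<exists>\<tau>. cyclic_subpermutation \<tau> \<sigma> \<and> cyc_increasing \<tau> \<and> cyc_length \<tau> = k + 1) \<or>
        (\<exists>\<tau>. cyclic_subpermutation \<tau> \<sigma> \<and> cyc_decreasing \<tau> \<and> cyc_length \<tau> = l + 1)"
      by (simp add: kl)
  next
    fix m :: nat
    assume m: "0 < m \<and> (\<forall>\<sigma>. cyclic_permutation_of {1..int m} \<sigma> \<longrightarrow>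
        (\<exists>\<tau>. cyclic_subpermutation \<tau> \<sigma> \<and> cyc_increasing \<tau> \<and> cyc_length \<tau> = k + 1) \<or>
        (\<exists>\<tau>. cyclic_subpermutation \<tau> \<sigma> \<and> cyc_decreasing \<tau> \<and> cyc_length \<tau> = l + 1))"
    interpret extremal_arrangement K L .
    show "K * L + 2 \<le> m"
    proof (rule ccontr)
      assume "\<not> K * L + 2 \<le> m"
      then have "int m \<le> int (K * L + 1)"
        by linarith
      then have "int m \<le> N"
        by (simp add: N_def)
      then obtain \<sigma> where "cyclic_permutation_of {1..int m} \<sigma>"
        "\<And>\<tau>. cyclic_subpermutation \<tau> \<sigma> \<Longrightarrow> cyc_increasing \<tau> \<Longrightarrow> cyc_length \<tau> \<le> K + 1"
        "\<And>\<tau>. cyclic_subpermutation \<tau> \<sigma> \<Longrightarrow> cyc_decreasing \<tau> \<Longrightarrow> cyc_length \<tau> \<le> L + 1"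
        by (rule cyclic_permutation_without_long_monotone) blast
      then show False
        using m by (fastforce simp: kl)
    qed
  qed simp
  then show ?thesis
    by (simp add: K_def L_def)
qed

end
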